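(* Let $G$ be a finite group and let $C$ be a finite acyclic category with a $G$-action. Let $\phi:C\rightarrow C$ be a $G$-equivariant AC-map that induces a trisp closure map $\bar\phi:B\rightarrow R$ on $\Delta(C)$, where $B$ and $R$ are closed under $G$ (that is, $G\cdot B\cap G\cdot R=\emptyset$). Then the quotient map $\bar\phi_G$, given by $\bar\phi_G(Gb)=G\bar\phi(b)$ for $b\in B$, with blue vertices $\{Gb : b\in B\}$ and red vertices $\{Gr : r\in R\}$, is a trisp closure map on $\Delta(C)/G$.
   Context: An acyclic category is a category in which only identity morphisms have inverses and every endomorphism is an identity. An AC-map on $C$ is a functor $\phi:C\to C$. An action of $G$ on $C$ is an action by automorphisms of the category $C$; a functor $\phi$ is $G$-equivariant if it commutes with the automorphism given by each $g\in G$. That $\phi$ induces a trisp closure map $\bar\phi:B\to R$ on $\Delta(C)$ means: the object set of $C$ is partitioned into $B$ and $R$, $\phi(B)\subseteq R$, and $\bar\phi=\phi|_B$ is a trisp closure map on $\Delta(C)$. A trisp (triangulated space, $\Delta$-complex, semisimplicial set) $T$ consists of sets $S_n(T)$, $n\ge 0$, of $n$-simplices together with boundary maps $\partial_i:S_n(T)\to S_{n-1}(T)$, $0\le i\le n$, satisfying $\partial_i\partial_j=\partial_{j-1}\partial_i$ for $i<j$. Every $n$-simplex has an ordered list of vertices $v_0,\dots,v_n$, and "minimal" refers to this order. It is regular if each $n$-simplex has $n+1$ distinct vertices. The nerve $\Delta(C)$ is the (regular) trisp whose vertices are the objects of $C$ and whose $t$-simplices are chains $a_0\stackrel{m_1}{\rightarrow}a_1\rightarrow\cdots\stackrel{m_t}{\rightarrow}a_t$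 of $t$ composable non-identity morphisms; $\partial_0$ and $\partial_t$ delete $a_0$, respectively $a_t$, and $\partial_i$ for $0<i<t$ deletes $a_i$ and composes $m_{i+1}\circ m_i$. The $G$-action on $C$ induces one on $\Delta(C)$; $\Delta(C)/G$ is the (regular) trisp whose simplices are the orbits $G\sigma$ of simplices of $\Delta(C)$, with $\partial_i(G\sigma)=G(\partial_i\sigma)$. A trisp closure map on a regular trisp $T$ is a partition of the vertex set into blue vertices $B$ and red vertices $R$, together with a map $\phi:B\to R$ such that for every simplex $\sigma$ of $T$ containing at least one blue vertex, with $b$ its minimal blue vertex, one of the following holds: either $\phi(b)$ is a vertex of $\sigma$, and removing $\phi(b)$ from $\sigma$ yields another (unique) simplex of $T$; or $\phi(b)$ is not a vertex of $\sigma$, and there exists a unique simplex $\tau$ of $T$ that contains $\phi(b)$ as a vertex and $\sigma$ as a boundary simplex of codimension $1$. *)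

theory Defs
  imports "HOL-Algebra.Group_Action"
begin

section \<open>Categories\<close>

text \<open>\<open>cmp C g f\<close> is the composite \<open>g \<circ> f\<close>, meaningful when \<open>tgt C f = src C g\<close>.\<close>

record ('o, 'm) category =
  obs :: "'o set"
  mors :: "'m set"
  src :: "'m \<Rightarrow> 'o"
  tgt :: "'m \<Rightarrow> 'o"
  idm :: "'o \<Rightarrow> 'm"
  cmp :: "'m \<Rightarrow> 'm \<Rightarrow> 'm"

locale category =
  fixes C :: "('o, 'm) category"
  assumes src_closed: "f \<in> mors C \<Longrightarrow> src C f \<in> obs C"
    and tgt_closed: "f \<in> mors C \<Longrightarrow> tgt C f \<in> obs C"
    and id_closed: "a \<in> obs C \<Longrightarrow> idm C a \<in> mors C"
    and src_id: "a \<in> obs C \<Longrightarrow> src C (idm C a) = a"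
    and tgt_id: "a \<in> obs C \<Longrightarrow> tgt C (idm C a) = a"
    and cmp_closed: "\<lbrakk>f \<in> mors C; g \<in> mors C; tgt C f = src C g\<rbrakk> \<Longrightarrow> cmp C g f \<in> mors C"
    and src_cmp: "\<lbrakk>f \<in> mors C; g \<in> mors C; tgt C f = src C g\<rbrakk> \<Longrightarrow> src C (cmp C g f) = src C f"
    and tgt_cmp: "\<lbrakk>f \<in> mors C; g \<in> mors C; tgt C f = src C g\<rbrakk> \<Longrightarrow> tgt C (cmp C g f) = tgt C g"
    and cmp_id_right: "f \<in> mors C \<Longrightarrow> cmp C f (idm C (src C f)) = f"
    and cmp_id_left: "f \<in> mors C \<Longrightarrow> cmp C (idm C (tgt C f)) f = f"
    and cmp_assoc: "\<lbrakk>f \<in> mors C; g \<in> mors C; h \<in> mors C; tgt C f = src C g; tgt C g = src C h\<rbrakk>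
      \<Longrightarrow> cmp C h (cmp C g f) = cmp C (cmp C h g) f"

definition identities :: "('o, 'm) category \<Rightarrow> 'm set" where
  "identities C = idm C ` obs C"

definition has_inverse :: "('o, 'm) category \<Rightarrow> 'm \<Rightarrow> bool" where
  "has_inverse C f \<longleftrightarrow>
     (\<exists>g\<in>mors C. src C g = tgt C f \<and> tgt C g = src C f \<and>
        cmp C g f = idm C (src C f) \<and> cmp C f g = idm C (tgt C f))"

locale acyclic_category = category +
  assumes inverse_imp_id: "\<lbrakk>f \<in> mors C; has_inverse C f\<rbrakk> \<Longrightarrow> f \<in> identities C"
    and endo_imp_id: "\<lbrakk>f \<in> mors C; src C f = tgt C f\<rbrakk> \<Longrightarrow> f \<in> identities C"

locale finite_acyclic_category = acyclic_category +
  assumes finite_obs: "finite (obs C)"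
    and finite_mors: "finite (mors C)"

locale cat_functor = source: category C + target: category D
  for C :: "('o, 'm) category" and D :: "('p, 'n) category" +
  fixes Fo :: "'o \<Rightarrow> 'p" and Fm :: "'m \<Rightarrow> 'n"
  assumes Fo_closed: "a \<in> obs C \<Longrightarrow> Fo a \<in> obs D"
    and Fm_closed: "f \<in> mors C \<Longrightarrow> Fm f \<in> mors D"
    and F_src: "f \<in> mors C \<Longrightarrow> src D (Fm f) = Fo (src C f)"
    and F_tgt: "f \<in> mors C \<Longrightarrow> tgt D (Fm f) = Fo (tgt C f)"
    and F_id: "a \<in> obs C \<Longrightarrow> Fm (idm C a) = idm D (Fo a)"
    and F_cmp: "\<lbrakk>f \<in> mors C; g \<in> mors C; tgt C f = src C g\<rbrakk>
      \<Longrightarrow> Fm (cmp C g f) = cmp D (Fm g) (Fm f)"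

abbreviation AC_map :: "('o, 'm) category \<Rightarrow> ('o \<Rightarrow> 'o) \<Rightarrow> ('m \<Rightarrow> 'm) \<Rightarrow> bool" where
  "AC_map C \<equiv> cat_functor C C"

definition cat_automorphism :: "('o, 'm) category \<Rightarrow> ('o \<Rightarrow> 'o) \<Rightarrow> ('m \<Rightarrow> 'm) \<Rightarrow> bool" where
  "cat_automorphism C Fo Fm \<longleftrightarrow>
     cat_functor C C Fo Fm \<and> bij_betw Fo (obs C) (obs C) \<and> bij_betw Fm (mors C) (mors C)"

locale category_action =
  category C +
  obs_action: group_action G "obs C" \<alpha>o +
  mors_action: group_action G "mors C" \<alpha>m
  for G :: "('g, 'x) monoid_scheme" (structure)
    and C :: "('o, 'm) category"
    and \<alpha>o :: "'g \<Rightarrow> 'o \<Rightarrow> 'o" and \<alpha>m :: "'g \<Rightarrow> 'm \<Rightarrow> 'm" +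
  assumes automorphism: "g \<in> carrier G \<Longrightarrow> cat_automorphism C (\<alpha>o g) (\<alpha>m g)"

definition equivariant_functor ::
  "('g, 'x) monoid_scheme \<Rightarrow> ('o, 'm) category \<Rightarrow> ('g \<Rightarrow> 'o \<Rightarrow> 'o) \<Rightarrow> ('g \<Rightarrow> 'm \<Rightarrow> 'm)
     \<Rightarrow> ('o \<Rightarrow> 'o) \<Rightarrow> ('m \<Rightarrow> 'm) \<Rightarrow> bool" where
  "equivariant_functor G C \<alpha>o \<alpha>m \<phi>o \<phi>m \<longleftrightarrow>
     (\<forall>g\<in>carrier G. (\<forall>a\<in>obs C. \<phi>o (\<alpha>o g a) = \<alpha>o g (\<phi>o a)) \<and>
                    (\<forall>f\<in>mors C. \<phi>m (\<alpha>m g f) = \<alpha>m g (\<phi>m f)))"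


section \<open>Trisps\<close>

text \<open>\<open>simps T n\<close> is the set of \<open>n\<close>-simplices and \<open>bd T n i\<close> is the boundary map
  \<open>\<partial>\<^sub>i\<close> on \<open>n\<close>-simplices, relevant only for \<open>n \<ge> 1\<close> and \<open>i \<le> n\<close>.
  The sets \<open>simps T n\<close> need not be disjoint, so a simplex always comes with its dimension.\<close>

record 's trisp =
  simps :: "nat \<Rightarrow> 's set"
  bd :: "nat \<Rightarrow> nat \<Rightarrow> 's \<Rightarrow> 's"

locale trisp =
  fixes T :: "'s trisp"
  assumes bd_closed: "\<lbrakk>i \<le> Suc n; \<sigma> \<in> simps T (Suc n)\<rbrakk> \<Longrightarrow> bd T (Suc n) i \<sigma> \<in> simps T n"
    and bd_bd: "\<lbrakk>i < j; j \<le> Suc (Suc n); \<sigma> \<in> simps T (Suc (Suc n))\<rbrakk>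
      \<Longrightarrow> bd T (Suc n) i (bd T (Suc (Suc n)) j \<sigma>) = bd T (Suc n) (j - 1) (bd T (Suc (Suc n)) i \<sigma>)"

text \<open>\<open>vert T n \<sigma> i\<close> is the vertex \<open>v\<^sub>i\<close> of the \<open>n\<close>-simplex \<open>\<sigma>\<close> (for \<open>i \<le> n\<close>): the
  \<open>0\<close>-simplex left after deleting all other positions. By the simplicial identities the order of
  deletion is irrelevant; here the last position is deleted as long as it is not the one
  to be kept, and then the first one.\<close>

fun vert :: "'s trisp \<Rightarrow> nat \<Rightarrow> 's \<Rightarrow> nat \<Rightarrow> 's" where
  "vert T 0 \<sigma> i = \<sigma>"
| "vert T (Suc n) \<sigma> i =
     (if i \<le> n then vert T n (bd T (Suc n) (Suc n) \<sigma>) i else vert T n (bd T (Suc n) 0 \<sigma>) n)"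

definition verts :: "'s trisp \<Rightarrow> nat \<Rightarrow> 's \<Rightarrow> 's set" where
  "verts T n \<sigma> = vert T n \<sigma> ` {..n}"

locale regular_trisp = trisp +
  assumes distinct_verts: "\<sigma> \<in> simps T n \<Longrightarrow> inj_on (vert T n \<sigma>) {..n}"

text \<open>\<open>min_blue T B n \<sigma> b\<close>: \<open>b\<close> is the first vertex of \<open>\<sigma>\<close>, in the vertex order of \<open>\<sigma>\<close>,
  that lies in \<open>B\<close>.\<close>

definition min_blue :: "'s trisp \<Rightarrow> 's set \<Rightarrow> nat \<Rightarrow> 's \<Rightarrow> 's \<Rightarrow> bool" where
  "min_blue T B n \<sigma> b \<longleftrightarrow>
     (\<exists>k\<le>n. vert T n \<sigma> k = b \<and> b \<in> B \<and> (\<forall>j<k. vert T n \<sigma> j \<notin> B))"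

definition trisp_closure_map :: "'s trisp \<Rightarrow> 's set \<Rightarrow> 's set \<Rightarrow> ('s \<Rightarrow> 's) \<Rightarrow> bool" where
  "trisp_closure_map T B R \<phi> \<longleftrightarrow>
     regular_trisp T \<and> B \<union> R = simps T 0 \<and> B \<inter> R = {} \<and> \<phi> ` B \<subseteq> R \<and>
     (\<forall>n. \<forall>\<sigma>\<in>simps T n. \<forall>b. min_blue T B n \<sigma> b \<longrightarrow>
        (\<phi> b \<in> verts T n \<sigma> \<and>
         n \<ge> 1 \<and> (\<exists>!\<rho>. \<rho> \<in> simps T (n - 1) \<and> (\<exists>i\<le>n. vert T n \<sigma> i = \<phi> b \<and> \<rho> = bd T n i \<sigma>)))
      \<or> (\<phi> b \<notin> verts T n \<sigma> \<and>
         (\<exists>!\<tau>. \<tau> \<in> simps T (Suc n) \<and> \<phi> b \<in> verts T (Suc n) \<tau> \<and>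
               (\<exists>i\<le>Suc n. bd T (Suc n) i \<tau> = \<sigma>))))"

text \<open>The quotient of a trisp by a group acting on its simplices, compatibly with the boundary
  maps. As the boundary maps are equivariant, the image of the orbit of \<open>\<sigma>\<close> under
  \<open>\<partial>\<^sub>i\<close> is the orbit of \<open>\<partial>\<^sub>i \<sigma>\<close>; for nerves this is \<open>bd_quotient_nerve\<close> below.\<close>

definition quotient_trisp ::
  "('g, 'x) monoid_scheme \<Rightarrow> ('g \<Rightarrow> 's \<Rightarrow> 's) \<Rightarrow> 's trisp \<Rightarrow> 's set trisp" where
  "quotient_trisp G \<alpha> T =
     \<lparr>simps = (\<lambda>n. orbits G (simps T n) \<alpha>), bd = (\<lambda>n i. (`) (bd T n i))\<rparr>"


section \<open>The nerve of a category\<close>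

text \<open>The simplex \<open>a\<^sub>0 \<rightarrow> a\<^sub>1 \<rightarrow> \<dots> \<rightarrow> a\<^sub>t\<close> with morphisms \<open>m\<^sub>1, \<dots>, m\<^sub>t\<close> is encoded as the pair
  \<open>(a\<^sub>0, [m\<^sub>1, \<dots>, m\<^sub>t])\<close>; in particular \<open>(a, [])\<close> is the vertex given by the object \<open>a\<close>.
  Since lists are indexed from \<open>0\<close>, \<open>m\<^sub>i\<close> is \<open>ms ! (i - 1)\<close>.\<close>

fun is_chain :: "('o, 'm) category \<Rightarrow> 'o \<Rightarrow> 'm list \<Rightarrow> bool" where
  "is_chain C a [] \<longleftrightarrow> a \<in> obs C"
| "is_chain C a (m # ms) \<longleftrightarrow>
     m \<in> mors C \<and> m \<notin> identities C \<and> src C m = a \<and> is_chain C (tgt C m) ms"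

fun nerve_bd :: "('o, 'm) category \<Rightarrow> nat \<Rightarrow> nat \<Rightarrow> 'o \<times> 'm list \<Rightarrow> 'o \<times> 'm list" where
  "nerve_bd C t i (a, ms) =
     (if i = 0 then (tgt C (hd ms), tl ms)
      else if i = t then (a, butlast ms)
      else (a, take (i - 1) ms @ [cmp C (ms ! i) (ms ! (i - 1))] @ drop (i + 1) ms))"

definition nerve :: "('o, 'm) category \<Rightarrow> ('o \<times> 'm list) trisp" where
  "nerve C = \<lparr>simps = (\<lambda>t. {(a, ms). length ms = t \<and> is_chain C a ms}), bd = nerve_bd C\<rparr>"

definition nerve_vertex :: "'o \<Rightarrow> 'o \<times> 'm list" where
  "nerve_vertex a = (a, [])"

text \<open>The map on vertices of the nerve given by a map on objects.\<close>

definition nerve_vertex_map :: "('o \<Rightarrow> 'o) \<Rightarrow> 'o \<times> 'm list \<Rightarrow> 'o \<times> 'm list" where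
  "nerve_vertex_map \<phi>o v = nerve_vertex (\<phi>o (fst v))"

definition induces_closure_map ::
  "('o, 'm) category \<Rightarrow> ('o \<Rightarrow> 'o) \<Rightarrow> 'o set \<Rightarrow> 'o set \<Rightarrow> bool" where
  "induces_closure_map C \<phi>o B R \<longleftrightarrow>
     B \<union> R = obs C \<and> B \<inter> R = {} \<and> \<phi>o ` B \<subseteq> R \<and>
     trisp_closure_map (nerve C) (nerve_vertex ` B) (nerve_vertex ` R) (nerve_vertex_map \<phi>o)"

definition nerve_action ::
  "('g \<Rightarrow> 'o \<Rightarrow> 'o) \<Rightarrow> ('g \<Rightarrow> 'm \<Rightarrow> 'm) \<Rightarrow> 'g \<Rightarrow> 'o \<times> 'm list \<Rightarrow> 'o \<times> 'm list" where
  "nerve_action \<alpha>o \<alpha>m g \<sigma> = (\<alpha>o g (fst \<sigma>), map (\<alpha>m g) (snd \<sigma>))"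

abbreviation quotient_nerve ::
  "('g, 'x) monoid_scheme \<Rightarrow> ('o, 'm) category \<Rightarrow> ('g \<Rightarrow> 'o \<Rightarrow> 'o) \<Rightarrow> ('g \<Rightarrow> 'm \<Rightarrow> 'm)
     \<Rightarrow> ('o \<times> 'm list) set trisp" where
  "quotient_nerve G C \<alpha>o \<alpha>m \<equiv> quotient_trisp G (nerve_action \<alpha>o \<alpha>m) (nerve C)"

definition vertex_orbit ::
  "('g, 'x) monoid_scheme \<Rightarrow> ('g \<Rightarrow> 'o \<Rightarrow> 'o) \<Rightarrow> ('g \<Rightarrow> 'm \<Rightarrow> 'm) \<Rightarrow> 'o \<Rightarrow> ('o \<times> 'm list) set" where
  "vertex_orbit G \<alpha>o \<alpha>m a = orbit G (nerve_action \<alpha>o \<alpha>m) (nerve_vertex a)"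

text \<open>The quotient map is the elementwise image of an orbit of vertices; for an equivariant
  functor it sends the orbit of \<open>b\<close> to the orbit of \<open>\<phi>o b\<close>.\<close>

definition quotient_vertex_map :: "('o \<Rightarrow> 'o) \<Rightarrow> ('o \<times> 'm list) set \<Rightarrow> ('o \<times> 'm list) set" where
  "quotient_vertex_map \<phi>o V = nerve_vertex_map \<phi>o ` V"

lemma is_chain_mors: "is_chain C a ms \<Longrightarrow> set ms \<subseteq> mors C"
  by (induction ms arbitrary: a) auto

lemma is_chain_composable:
  "\<lbrakk>is_chain C a ms; Suc i < length ms\<rbrakk> \<Longrightarrow> tgt C (ms ! i) = src C (ms ! Suc i)"
proof (induction ms arbitrary: a i)
  case (Cons m ms)
  then show ?case by (cases i; cases ms) auto
qed simp

lemma (in category_action) nerve_bd_equivariant: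
  assumes "g \<in> carrier G" "\<sigma> \<in> simps (nerve C) (Suc n)" "i \<le> Suc n"
  shows "bd (nerve C) (Suc n) i (nerve_action \<alpha>o \<alpha>m g \<sigma>)
       = nerve_action \<alpha>o \<alpha>m g (bd (nerve C) (Suc n) i \<sigma>)"
proof -
  obtain a ms where \<sigma>: "\<sigma> = (a, ms)" "length ms = Suc n" "is_chain C a ms"
    using assms(2) by (auto simp: nerve_def)
  interpret F: cat_functor C C "\<alpha>o g" "\<alpha>m g"
    using automorphism[OF assms(1)] by (simp add: cat_automorphism_def)
  note mors = is_chain_mors[OF \<sigma>(3)]
  consider "i = 0" | "i = Suc n" "i \<noteq> 0" | k where "i = Suc k" "Suc k < length ms"
    using assms(3) \<sigma>(2) by (cases i) fastforce+
  then show ?thesis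
  proof cases
    case 1
    then show ?thesis using \<sigma> mors F.F_tgt
      by (cases ms) (auto simp: nerve_def nerve_action_def)
  next
    case 2
    then show ?thesis using \<sigma> by (auto simp: nerve_def nerve_action_def map_butlast)
  next
    case 3
    then have "ms ! k \<in> mors C" "ms ! Suc k \<in> mors C"
      using mors by (auto simp: subset_iff)
    then have "\<alpha>m g (cmp C (ms ! Suc k) (ms ! k)) = cmp C (\<alpha>m g (ms ! Suc k)) (\<alpha>m g (ms ! k))"
      using F.F_cmp is_chain_composable[OF \<sigma>(3) 3(2)] by simp
    then show ?thesis using \<sigma> 3
      by (auto simp: nerve_def nerve_action_def take_map drop_map)
  qed
qed

lemma (in category_action) bd_quotient_nerve:
  assumes "\<sigma> \<in> simps (nerve C) (Suc n)" "i \<le> Suc n"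
  shows "bd (quotient_nerve G C \<alpha>o \<alpha>m) (Suc n) i (orbit G (nerve_action \<alpha>o \<alpha>m) \<sigma>)
       = orbit G (nerve_action \<alpha>o \<alpha>m) (bd (nerve C) (Suc n) i \<sigma>)"
proof -
  have "bd (nerve C) (Suc n) i ` (\<lambda>g. nerve_action \<alpha>o \<alpha>m g \<sigma>) ` carrier G
      = (\<lambda>g. nerve_action \<alpha>o \<alpha>m g (bd (nerve C) (Suc n) i \<sigma>)) ` carrier G"
    unfolding image_image using nerve_bd_equivariant[OF _ assms] by (rule image_cong[OF refl])
  then show ?thesis
    by (simp add: quotient_trisp_def orbit_def Setcompr_eq_image)
qed

end

theory Submission
  imports Defs "HOL-Algebra.Multiplicative_Group"
begin

text \<open>The quotient of a trisp by a group action is governed by one property of the action, called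
  rigidity below: two vertices of a common simplex that lie in the same orbit are equal. It
  immediately makes the quotient of a regular trisp regular. It also makes an equivariant closure
  map descend. Let \<open>b\<close> be the minimal blue vertex of \<open>\<sigma>\<close> and suppose that \<open>\<sigma>\<close> is completed by
  \<open>\<phi> b\<close> to the simplex \<open>\<tau>\<close>. Another coface of the orbit of \<open>\<sigma>\<close> that contains the orbit of \<open>\<phi> b\<close>
  can be translated to a coface \<open>\<tau>'\<close> of \<open>\<sigma>\<close> itself, but then it contains only some translate
  \<open>g \<phi> b\<close>. This translate is red and, by rigidity of \<open>\<tau>\<close>, not a vertex of \<open>\<sigma>\<close>, so \<open>b\<close> is still the minimal blue vertex of \<open>\<tau>'\<close>. Hence the
  closure property, applied to \<open>\<tau>'\<close>, puts \<open>\<phi> b\<close> into \<open>\<tau>'\<close> or into a coface of \<open>\<tau>'\<close>. Now \<open>\<phi> b\<close> and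
  \<open>g \<phi> b\<close> share a simplex, so they are equal by rigidity, and \<open>\<tau>' = \<tau>\<close> by the uniqueness
  of \<open>\<tau>\<close>. This is \<open>trisp_closure_map_quotient\<close>, with \<open>translate_of_companion\<close> as its core.

  The nerve of an acyclic category is rigid under every action of a finite group: vertices of a
  common simplex are joined by a morphism, and a morphism \<open>a \<rightarrow> g a\<close> can be translated and
  continued to \<open>a \<rightarrow> g a \<rightarrow> g\<^sup>2 a \<rightarrow> \<dots> \<rightarrow> a\<close>. In an acyclic category this forces \<open>a = g a\<close>.\<close>

section \<open>Vertices of faces and cofaces\<close>

text \<open>The coface map \<open>\<delta>\<^sup>i\<close> of the simplex category.\<close>

definition skip :: "nat \<Rightarrow> nat \<Rightarrow> nat" where
  "skip i j = (if j < i then j else Suc j)"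

text \<open>The function \<open>vert\<close> deletes positions in one particular order; the simplicial
  identities move an arbitrary deletion \<open>\<partial>\<^sub>i\<close> past the deletions at the two ends.\<close>

lemma (in trisp) vert_bd:
  assumes "\<sigma> \<in> simps T (Suc n)" "i \<le> Suc n" "j \<le> n"
  shows "vert T n (bd T (Suc n) i \<sigma>) j = vert T (Suc n) \<sigma> (skip i j)"
  using assms
proof (induction n arbitrary: \<sigma> i j)
  case 0
  then show ?case by (cases i) (auto simp: skip_def)
next
  case (Suc m)
  let ?last = "bd T (Suc (Suc m)) (Suc (Suc m)) \<sigma>" and ?first = "bd T (Suc (Suc m)) 0 \<sigma>"
  have closed: "?last \<in> simps T (Suc m)" "?first \<in> simps T (Suc m)"
    using bd_closed Suc.prems by auto
  consider (top) "i = Suc (Suc m)" | (low) "i \<le> Suc m" "j \<le> m" | (bot) "i = 0" "j = Suc m"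
    | (mid) "0 < i" "i \<le> Suc m" "j = Suc m"
    using Suc.prems by linarith
  then show ?case
  proof cases
    case top
    then show ?thesis using Suc.prems by (simp add: skip_def)
  next
    case low
    have "bd T (Suc m) (Suc m) (bd T (Suc (Suc m)) i \<sigma>) = bd T (Suc m) i ?last"
      using bd_bd[of i "Suc (Suc m)" m \<sigma>] low Suc.prems by simp
    then show ?thesis
      using Suc.IH[OF closed(1), of i j] low by (auto simp: skip_def)
  next
    case bot
    then show ?thesis by (simp add: skip_def)
  next
    case mid
    have "bd T (Suc m) 0 (bd T (Suc (Suc m)) i \<sigma>) = bd T (Suc m) (i - 1) ?first"
      using bd_bd[of 0 i m \<sigma>] mid Suc.prems by simp
    then show ?thesis
      using Suc.IH[OF closed(2), of "i - 1" m] mid by (auto simp: skip_def)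
  qed
qed

(* Unfolding would express the vertices of a simplex by those of its two outer faces, whereas
   the arguments below compare positions directly by vert_bd. *)
declare vert.simps(2) [simp del]

lemma skip_cases:
  assumes "k \<le> Suc n" "i \<le> Suc n"
  obtains "k = i" | j where "j \<le> n" "k = skip i j"
proof (cases k i rule: linorder_cases)
  case less
  then show ?thesis using that(2)[of k] assms by (simp add: skip_def)
next
  case greater
  then show ?thesis using that(2)[of "k - 1"] assms by (simp add: skip_def)
qed (use that in simp)

lemma (in trisp) verts_bd_subset:
  assumes "\<tau> \<in> simps T (Suc n)" "i \<le> Suc n"
  shows "verts T n (bd T (Suc n) i \<tau>) \<subseteq> verts T (Suc n) \<tau>"
  using vert_bd[OF assms] by (auto simp: verts_def skip_def)

text \<open>The vertex of a coface that is not a vertex of the face sits at the deleted position, so a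
  non-blue one does not change which blue vertex comes first.\<close>

lemma (in trisp) min_blue_coface:
  assumes \<tau>: "\<tau> \<in> simps T (Suc n)" "i \<le> Suc n"
    and blue: "min_blue T B n (bd T (Suc n) i \<tau>) b"
    and r: "r \<in> verts T (Suc n) \<tau>" "r \<notin> verts T n (bd T (Suc n) i \<tau>)" "r \<notin> B"
  shows "min_blue T B (Suc n) \<tau> b"
proof -
  obtain k where k: "k \<le> n" "vert T n (bd T (Suc n) i \<tau>) k = b" "b \<in> B"
      "\<forall>j<k. vert T n (bd T (Suc n) i \<tau>) j \<notin> B"
    using blue by (auto simp: min_blue_def)
  obtain l where l: "l \<le> Suc n" "vert T (Suc n) \<tau> l = r"
    using r(1) by (auto simp: verts_def)
  have i: "vert T (Suc n) \<tau> i = r"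
    using l(1) \<tau>(2)
  proof (cases rule: skip_cases)
    case (2 j)
    then have "r \<in> verts T n (bd T (Suc n) i \<tau>)"
      using vert_bd[OF \<tau>, of j] l(2) by (auto simp: verts_def)
    then show ?thesis using r(2) by simp
  qed (use l in simp)
  have "vert T (Suc n) \<tau> j \<notin> B" if j: "j < skip i k" for j
  proof -
    have "j \<le> Suc n" using j k(1) by (auto simp: skip_def split: if_splits)
    then show ?thesis using \<tau>(2)
    proof (cases rule: skip_cases)
      case (2 j')
      then have "j' < k" using j by (auto simp: skip_def split: if_splits)
      then show ?thesis using vert_bd[OF \<tau>, of j'] 2 k(4) by metis
    qed (use i r(3) in \<open>simp del: vert.simps\<close>)
  qed
  moreover have "vert T (Suc n) \<tau> (skip i k) = b"
    using vert_bd[OF \<tau> k(1)] k(2) by simp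
  moreover have "skip i k \<le> Suc n" using k(1) by (simp add: skip_def)
  ultimately show ?thesis using k(3) unfolding min_blue_def by blast
qed

lemma trisp_closure_map_coface:
  assumes cm: "trisp_closure_map T B R \<phi>"
    and \<sigma>: "\<sigma> \<in> simps T n" "min_blue T B n \<sigma> b" "\<phi> b \<notin> verts T n \<sigma>"
  shows "\<exists>!\<tau>. \<tau> \<in> simps T (Suc n) \<and> \<phi> b \<in> verts T (Suc n) \<tau> \<and>
    (\<exists>i\<le>Suc n. bd T (Suc n) i \<tau> = \<sigma>)"
  using cm[unfolded trisp_closure_map_def, THEN conjunct2, THEN conjunct2, THEN conjunct2,
      THEN conjunct2, rule_format, OF \<sigma>(1,2)]
proof (elim disjE conjE)
  assume "\<phi> b \<in> verts T n \<sigma>"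
  then show ?thesis using \<sigma>(3) by (rule notE[rotated])
qed assumption

section \<open>Group actions on trisps\<close>

text \<open>One function \<open>\<alpha> g\<close> serves all dimensions, so in general it is not extensional on each set of
  simplices, as an instance of \<open>group_action\<close> would have to be.\<close>

locale trisp_action = group G + trisp T
  for G :: "('g, 'x) monoid_scheme" (structure) and T :: "'s trisp" +
  fixes \<alpha> :: "'g \<Rightarrow> 's \<Rightarrow> 's"
  assumes act_closed: "\<lbrakk>g \<in> carrier G; \<sigma> \<in> simps T n\<rbrakk> \<Longrightarrow> \<alpha> g \<sigma> \<in> simps T n"
    and act_one: "\<sigma> \<in> simps T n \<Longrightarrow> \<alpha> \<one> \<sigma> = \<sigma>"
    and act_mult: "\<lbrakk>g \<in> carrier G; h \<in> carrier G; \<sigma> \<in> simps T n\<rbrakk> \<Longrightarrow> \<alpha> (g \<otimes> h) \<sigma> = \<alpha> g (\<alpha> h \<sigma>)"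
    and act_bd: "\<lbrakk>g \<in> carrier G; \<sigma> \<in> simps T (Suc n); i \<le> Suc n\<rbrakk>
      \<Longrightarrow> bd T (Suc n) i (\<alpha> g \<sigma>) = \<alpha> g (bd T (Suc n) i \<sigma>)"
begin

abbreviation orb :: "'s \<Rightarrow> 's set" where
  "orb \<equiv> orbit G \<alpha>"

abbreviation Q :: "'s set trisp" where
  "Q \<equiv> quotient_trisp G \<alpha> T"

lemma act_in_orb: "g \<in> carrier G \<Longrightarrow> \<alpha> g x \<in> orb x"
  by (auto simp: orbit_def)

lemma orb_eqD:
  assumes "x \<in> simps T n" "orb x = orb y"
  shows "\<exists>g\<in>carrier G. x = \<alpha> g y"
proof -
  have "x \<in> orb x" using act_in_orb[OF one_closed] act_one[OF assms(1)] by metis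
  then show ?thesis using assms(2) by (auto simp: orbit_def)
qed

lemma orb_act:
  assumes "x \<in> simps T n" "g \<in> carrier G"
  shows "orb (\<alpha> g x) = orb x"
proof
  show "orb (\<alpha> g x) \<subseteq> orb x"
  proof
    fix y assume "y \<in> orb (\<alpha> g x)"
    then obtain h where "h \<in> carrier G" "y = \<alpha> (h \<otimes> g) x"
      using act_mult[OF _ assms(2,1)] by (auto simp: orbit_def)
    then show "y \<in> orb x" using assms(2) act_in_orb by simp
  qed
  show "orb x \<subseteq> orb (\<alpha> g x)"
  proof
    fix y assume "y \<in> orb x"
    then obtain h where h: "h \<in> carrier G" "y = \<alpha> h x" by (auto simp: orbit_def)
    have "\<alpha> (h \<otimes> inv g) (\<alpha> g x) = \<alpha> (h \<otimes> inv g \<otimes> g) x"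
      using act_mult[of "h \<otimes> inv g" g x] assms h by simp
    also have "\<dots> = y" using assms h by (simp add: m_assoc)
    finally show "y \<in> orb (\<alpha> g x)"
      using act_in_orb[of "h \<otimes> inv g" "\<alpha> g x"] h assms by simp
  qed
qed

lemma simps_Q: "simps Q n = orb ` simps T n"
  by (auto simp: quotient_trisp_def orbits_def)

lemma bd_Q:
  assumes "\<sigma> \<in> simps T (Suc n)" "i \<le> Suc n"
  shows "bd Q (Suc n) i (orb \<sigma>) = orb (bd T (Suc n) i \<sigma>)"
  using act_bd[OF _ assms]
  by (simp add: quotient_trisp_def orbit_def Setcompr_eq_image image_image)

lemma trisp_Q: "trisp Q"
proof
  show "bd Q (Suc n) i \<Sigma> \<in> simps Q n" if "i \<le> Suc n" "\<Sigma> \<in> simps Q (Suc n)" for i n \<Sigma>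
    using that by (auto simp: simps_Q bd_Q bd_closed)
  show "bd Q (Suc n) i (bd Q (Suc (Suc n)) j \<Sigma>) = bd Q (Suc n) (j - 1) (bd Q (Suc (Suc n)) i \<Sigma>)"
    if "i < j" "j \<le> Suc (Suc n)" "\<Sigma> \<in> simps Q (Suc (Suc n))" for i j n \<Sigma>
    using that by (auto simp: simps_Q bd_Q bd_closed bd_bd)
qed

lemma vert_Q:
  assumes "\<sigma> \<in> simps T n" "i \<le> n"
  shows "vert Q n (orb \<sigma>) i = orb (vert T n \<sigma> i)"
  using assms by (induction n arbitrary: \<sigma> i) (auto simp: bd_Q bd_closed vert.simps(2))

lemma verts_Q:
  assumes "\<sigma> \<in> simps T n"
  shows "verts Q n (orb \<sigma>) = orb ` verts T n \<sigma>"
  using vert_Q[OF assms] by (auto simp: verts_def image_iff)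

lemma vert_closed:
  assumes "\<sigma> \<in> simps T n" "i \<le> n"
  shows "vert T n \<sigma> i \<in> simps T 0"
  using assms by (induction n arbitrary: \<sigma> i) (auto simp: bd_closed vert.simps(2))

lemma verts_closed: "\<sigma> \<in> simps T n \<Longrightarrow> verts T n \<sigma> \<subseteq> simps T 0"
  by (auto simp: verts_def vert_closed)

end

section \<open>Closure maps on quotients by rigid actions\<close>

locale rigid_trisp_action = trisp_action +
  assumes rigid: "\<lbrakk>\<sigma> \<in> simps T n; u \<in> verts T n \<sigma>; g \<in> carrier G; \<alpha> g u \<in> verts T n \<sigma>\<rbrakk>
    \<Longrightarrow> \<alpha> g u = u"
begin

lemma regular_trisp_Q:
  assumes "regular_trisp T"
  shows "regular_trisp Q"
proof -
  interpret reg: regular_trisp T by fact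
  interpret Q: trisp Q by (rule trisp_Q)
  show ?thesis
  proof
    fix n \<Sigma> assume "\<Sigma> \<in> simps Q n"
    then obtain \<sigma> where \<sigma>: "\<sigma> \<in> simps T n" "\<Sigma> = orb \<sigma>" by (auto simp: simps_Q)
    show "inj_on (vert Q n \<Sigma>) {..n}"
    proof (rule inj_onI)
      fix i j assume ij: "i \<in> {..n}" "j \<in> {..n}" "vert Q n \<Sigma> i = vert Q n \<Sigma> j"
      then have "orb (vert T n \<sigma> i) = orb (vert T n \<sigma> j)" using \<sigma> by (simp add: vert_Q)
      then obtain g where g: "g \<in> carrier G" "vert T n \<sigma> i = \<alpha> g (vert T n \<sigma> j)"
        using orb_eqD[OF vert_closed[OF \<sigma>(1)]] ij(1) by blast
      moreover have "vert T n \<sigma> i \<in> verts T n \<sigma>" "vert T n \<sigma> j \<in> verts T n \<sigma>"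
        using ij by (auto simp: verts_def)
      ultimately have "vert T n \<sigma> i = vert T n \<sigma> j" using rigid[OF \<sigma>(1)] by simp
      then show "i = j" using reg.distinct_verts[OF \<sigma>(1)] ij(1,2) by (simp add: inj_on_eq_iff)
    qed
  qed
qed

text \<open>The closure property provides a simplex over \<open>\<sigma>\<close> (possibly \<open>\<sigma>\<close> itself) that contains
  \<open>\<phi> b\<close>. As it contains the translate of \<open>\<phi> b\<close> as well, rigidity applies to it.\<close>

lemma translate_of_companion:
  assumes cm: "trisp_closure_map T B R \<phi>"
    and \<sigma>: "\<sigma> \<in> simps T n" "min_blue T B n \<sigma> b"
    and g: "g \<in> carrier G" "\<alpha> g (\<phi> b) \<in> verts T n \<sigma>"
  shows "\<alpha> g (\<phi> b) = \<phi> b"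
proof (cases "\<phi> b \<in> verts T n \<sigma>")
  case True
  then show ?thesis using rigid[OF \<sigma>(1)] g by blast
next
  case False
  obtain \<tau> i where \<tau>: "\<tau> \<in> simps T (Suc n)" "\<phi> b \<in> verts T (Suc n) \<tau>"
      "i \<le> Suc n" "bd T (Suc n) i \<tau> = \<sigma>"
    using trisp_closure_map_coface[OF cm \<sigma> False] by (elim ex1E conjE exE) metis
  then have "\<alpha> g (\<phi> b) \<in> verts T (Suc n) \<tau>" using verts_bd_subset[of \<tau> n i] g(2) by auto
  then show ?thesis using rigid[OF \<tau>(1,2)] g(1) by blast
qed

theorem trisp_closure_map_quotient:
  assumes cm: "trisp_closure_map T B R \<phi>"
    and inv_B: "\<And>g b. \<lbrakk>g \<in> carrier G; b \<in> B\<rbrakk> \<Longrightarrow> \<alpha> g b \<in> B"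
    and equiv: "\<And>g b. \<lbrakk>g \<in> carrier G; b \<in> B\<rbrakk> \<Longrightarrow> \<phi> (\<alpha> g b) = \<alpha> g (\<phi> b)"
  shows "trisp_closure_map Q (orb ` B) (orb ` R) ((`) \<phi>)"
proof -
  have BR: "B \<union> R = simps T 0" "B \<inter> R = {}" "\<phi> ` B \<subseteq> R" and reg: "regular_trisp T"
    using cm by (simp_all add: trisp_closure_map_def)
  interpret regQ: regular_trisp Q by (rule regular_trisp_Q[OF reg])
  have orb_B: "x \<in> B" if "x \<in> simps T 0" "orb x \<in> orb ` B" for x
    using that orb_eqD[of x 0] inv_B by blast
  have \<phi>_orb: "\<phi> ` orb b = orb (\<phi> b)" if "b \<in> B" for b
    using equiv[OF _ that] by (simp add: orbit_def Setcompr_eq_image image_image)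
  have disj: "orb ` B \<inter> orb ` R = {}"
  proof (rule ccontr)
    assume "orb ` B \<inter> orb ` R \<noteq> {}"
    then obtain r where r: "r \<in> R" "orb r \<in> orb ` B" by blast
    then have "r \<in> B" using orb_B BR(1) by blast
    then show False using r(1) BR(2) by blast
  qed
  have "(\<phi> ` \<b> \<in> verts Q n \<Sigma> \<and>
         n \<ge> 1 \<and> (\<exists>!\<rho>. \<rho> \<in> simps Q (n - 1) \<and> (\<exists>i\<le>n. vert Q n \<Sigma> i = \<phi> ` \<b> \<and> \<rho> = bd Q n i \<Sigma>)))
      \<or> (\<phi> ` \<b> \<notin> verts Q n \<Sigma> \<and>
         (\<exists>!\<tau>. \<tau> \<in> simps Q (Suc n) \<and> \<phi> ` \<b> \<in> verts Q (Suc n) \<tau> \<and>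
               (\<exists>i\<le>Suc n. bd Q (Suc n) i \<tau> = \<Sigma>)))"
    if \<Sigma>: "\<Sigma> \<in> simps Q n" and blue: "min_blue Q (orb ` B) n \<Sigma> \<b>" for n \<Sigma> \<b>
  proof -
    obtain \<sigma> where \<sigma>: "\<sigma> \<in> simps T n" "\<Sigma> = orb \<sigma>" using \<Sigma> by (auto simp: simps_Q)
    obtain k where k: "k \<le> n" "vert Q n \<Sigma> k = \<b>" "\<b> \<in> orb ` B"
        "\<forall>j<k. vert Q n \<Sigma> j \<notin> orb ` B"
      using blue by (auto simp: min_blue_def)
    define b where "b = vert T n \<sigma> k"
    have \<b>: "\<b> = orb b" using k(1,2) \<sigma> by (simp add: vert_Q b_def)
    have b: "b \<in> B" using orb_B[of b] k(1,3) \<b> vert_closed \<sigma> by (simp add: b_def)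
    have "vert T n \<sigma> j \<notin> B" if "j < k" for j
      using k(4) that vert_Q[OF \<sigma>(1), of j] k(1) \<sigma>(2) by auto
    then have mb: "min_blue T B n \<sigma> b" using k(1) b unfolding min_blue_def b_def by blast
    have \<phi>b: "\<phi> ` \<b> = orb (\<phi> b)" using \<phi>_orb b \<b> by simp
    have red: "\<alpha> g (\<phi> b) \<notin> B" if "g \<in> carrier G" for g
      using equiv[OF that b] inv_B[OF that b] BR by (metis disjoint_iff image_subset_iff)
    show ?thesis
    proof (cases "\<phi> b \<in> verts T n \<sigma>")
      case True
      then have in_\<Sigma>: "\<phi> ` \<b> \<in> verts Q n \<Sigma>" using \<sigma> by (simp add: verts_Q \<phi>b)
      then obtain i where i: "i \<le> n" "vert Q n \<Sigma> i = \<phi> ` \<b>" by (auto simp: verts_def)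
      have uniq: "j = i" if "j \<le> n" "vert Q n \<Sigma> j = \<phi> ` \<b>" for j
        using inj_onD[OF regQ.distinct_verts[OF \<Sigma>], of j i] i that by simp
      have n: "n \<ge> 1" using True cm \<sigma>(1) mb unfolding trisp_closure_map_def by blast
      then have closed: "bd Q n i \<Sigma> \<in> simps Q (n - 1)" using regQ.bd_closed[of i "n - 1" \<Sigma>] \<Sigma> i by simp
      have "\<exists>!\<rho>. \<rho> \<in> simps Q (n - 1) \<and> (\<exists>i\<le>n. vert Q n \<Sigma> i = \<phi> ` \<b> \<and> \<rho> = bd Q n i \<Sigma>)"
      proof (rule ex1I[of _ "bd Q n i \<Sigma>"])
        fix \<rho> assume "\<rho> \<in> simps Q (n - 1) \<and> (\<exists>j\<le>n. vert Q n \<Sigma> j = \<phi> ` \<b> \<and> \<rho> = bd Q n j \<Sigma>)"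
        then obtain j where "j \<le> n" "vert Q n \<Sigma> j = \<phi> ` \<b>" "\<rho> = bd Q n j \<Sigma>" by auto
        then show "\<rho> = bd Q n i \<Sigma>" using uniq[of j] by simp
      qed (use i closed in auto)
      then show ?thesis using in_\<Sigma> n by blast
    next
      case False
      obtain \<tau> i where \<tau>: "\<tau> \<in> simps T (Suc n)" "\<phi> b \<in> verts T (Suc n) \<tau>"
          "i \<le> Suc n" "bd T (Suc n) i \<tau> = \<sigma>"
        and uniq: "\<And>\<tau>' j. \<lbrakk>\<tau>' \<in> simps T (Suc n); \<phi> b \<in> verts T (Suc n) \<tau>'; j \<le> Suc n;
            bd T (Suc n) j \<tau>' = \<sigma>\<rbrakk> \<Longrightarrow> \<tau>' = \<tau>"
        using trisp_closure_map_coface[OF cm \<sigma>(1) mb False] by (elim ex1E conjE exE) metis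
      have no_translate: "\<alpha> g (\<phi> b) \<notin> verts T n \<sigma>" if "g \<in> carrier G" for g
        using translate_of_companion[OF cm \<sigma>(1) mb that] False by auto
      have not_in_\<Sigma>: "\<phi> ` \<b> \<notin> verts Q n \<Sigma>"
      proof
        assume "\<phi> ` \<b> \<in> verts Q n \<Sigma>"
        then obtain v where "v \<in> verts T n \<sigma>" "orb v = orb (\<phi> b)"
          using \<sigma> by (auto simp: verts_Q \<phi>b)
        then show False using orb_eqD[of v 0] verts_closed[OF \<sigma>(1)] no_translate by blast
      qed
      have coface: "orb \<tau> \<in> simps Q (Suc n) \<and> \<phi> ` \<b> \<in> verts Q (Suc n) (orb \<tau>) \<and>
          (\<exists>i\<le>Suc n. bd Q (Suc n) i (orb \<tau>) = \<Sigma>)"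
        using \<tau> \<sigma> bd_Q[OF \<tau>(1,3)] by (auto simp: simps_Q verts_Q \<phi>b)
      have coface_unique: "\<T> = orb \<tau>"
        if \<T>: "\<T> \<in> simps Q (Suc n)" "\<phi> ` \<b> \<in> verts Q (Suc n) \<T>"
          "j \<le> Suc n" "bd Q (Suc n) j \<T> = \<Sigma>" for \<T> j
      proof -
        obtain \<tau>0 where \<tau>0: "\<tau>0 \<in> simps T (Suc n)" "\<T> = orb \<tau>0" using \<T>(1) by (auto simp: simps_Q)
        then have "orb \<sigma> = orb (bd T (Suc n) j \<tau>0)" using \<T>(3,4) \<sigma>(2) by (simp add: bd_Q)
        then obtain h where h: "h \<in> carrier G" "\<sigma> = \<alpha> h (bd T (Suc n) j \<tau>0)"
          using orb_eqD[OF \<sigma>(1)] by blast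
        define \<tau>' where "\<tau>' = \<alpha> h \<tau>0"
        have \<tau>': "\<tau>' \<in> simps T (Suc n)" "bd T (Suc n) j \<tau>' = \<sigma>" "\<T> = orb \<tau>'"
          using h \<tau>0 \<T>(3) act_closed act_bd orb_act unfolding \<tau>'_def by auto
        obtain v where v: "v \<in> verts T (Suc n) \<tau>'" "orb v = orb (\<phi> b)"
          using \<T>(2) \<tau>' by (auto simp: verts_Q \<phi>b)
        then obtain g where g: "g \<in> carrier G" "v = \<alpha> g (\<phi> b)"
          using orb_eqD[of v 0] verts_closed[OF \<tau>'(1)] by blast
        \<comment> \<open>the translate is red and new, so \<open>b\<close> stays minimal and the companion of \<open>\<tau>'\<close> is \<open>\<phi> b\<close>\<close>
        have "min_blue T B (Suc n) \<tau>' b"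
          using min_blue_coface[OF \<tau>'(1) \<T>(3)] mb \<tau>'(2) v(1) g no_translate red by blast
        then have "v = \<phi> b"
          using translate_of_companion[OF cm \<tau>'(1)] g v(1) by blast
        then show ?thesis using uniq[OF \<tau>'(1) _ \<T>(3) \<tau>'(2)] v(1) \<tau>'(3) by simp
      qed
      have "\<exists>!\<tau>. \<tau> \<in> simps Q (Suc n) \<and> \<phi> ` \<b> \<in> verts Q (Suc n) \<tau> \<and>
          (\<exists>i\<le>Suc n. bd Q (Suc n) i \<tau> = \<Sigma>)"
        using coface by (rule ex1I) (elim conjE exE, rule coface_unique)
      then show ?thesis using not_in_\<Sigma> by (intro disjI2 conjI)
    qed
  qed
  moreover have "orb ` B \<union> orb ` R = simps Q 0" using BR(1) by (simp add: simps_Q flip: image_Un)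
  moreover have "(`) \<phi> ` orb ` B \<subseteq> orb ` R" using BR(3) \<phi>_orb by auto
  ultimately show ?thesis
    unfolding trisp_closure_map_def using disj regQ.regular_trisp_axioms
    by (intro conjI allI ballI impI) assumption+
qed

end

section \<open>Finite groups acting on acyclic categories\<close>

definition arrow :: "('o, 'm) category \<Rightarrow> 'o \<Rightarrow> 'o \<Rightarrow> bool" where
  "arrow C a b \<longleftrightarrow> (\<exists>f\<in>mors C. src C f = a \<and> tgt C f = b)"

lemma (in category) arrow_refl: "a \<in> obs C \<Longrightarrow> arrow C a a"
  unfolding arrow_def using id_closed src_id tgt_id by blast

lemma (in category) arrow_trans: "\<lbrakk>arrow C a b; arrow C b c\<rbrakk> \<Longrightarrow> arrow C a c"
  unfolding arrow_def using cmp_closed src_cmp tgt_cmp by metis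

text \<open>Both composites of two opposite morphisms are endomorphisms, hence identities, so the two
  morphisms are mutually inverse, hence identities themselves.\<close>

lemma (in acyclic_category) arrow_antisym:
  assumes "arrow C a b" "arrow C b a"
  shows "a = b"
proof -
  obtain f g where f: "f \<in> mors C" "src C f = a" "tgt C f = b"
    and g: "g \<in> mors C" "src C g = b" "tgt C g = a"
    using assms by (auto simp: arrow_def)
  have endo: "e = idm C (src C e)" if e: "e \<in> mors C" "src C e = tgt C e" for e
    using endo_imp_id[OF e] src_id by (auto simp: identities_def)
  have "cmp C g f = idm C a"
    using endo[of "cmp C g f"] f g cmp_closed src_cmp tgt_cmp by simp
  moreover have "cmp C f g = idm C b"
    using endo[of "cmp C f g"] f g cmp_closed src_cmp tgt_cmp by simp
  ultimately have "has_inverse C f" unfolding has_inverse_def using f g by auto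
  then obtain c where "c \<in> obs C" "f = idm C c"
    using inverse_imp_id[OF f(1)] by (auto simp: identities_def)
  then show ?thesis using f(2,3) src_id tgt_id by simp
qed

lemma vert_nerve:
  assumes "length ms = n" "k \<le> n"
  shows "vert (nerve C) n (a, ms) k = nerve_vertex ((a # map (tgt C) ms) ! k)"
  using assms
proof (induction n arbitrary: a ms k)
  case 0
  then show ?case by (simp add: nerve_vertex_def)
next
  case (Suc n)
  show ?case
  proof (cases "k \<le> n")
    case True
    then have "vert (nerve C) (Suc n) (a, ms) k = vert (nerve C) n (a, butlast ms) k"
      by (simp add: nerve_def vert.simps(2))
    then show ?thesis
      using Suc True by (auto simp: nth_Cons' nth_butlast map_butlast)
  next
    case False
    then have "k = Suc n" using Suc.prems by simp
    moreover obtain m ms' where "ms = m # ms'" using Suc.prems by (cases ms) auto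
    ultimately show ?thesis using Suc by (simp add: nerve_def vert.simps(2))
  qed
qed

lemma (in category) is_chain_source_obs: "is_chain C a ms \<Longrightarrow> a \<in> obs C"
  using src_closed by (cases ms) auto

lemma (in category) arrow_between_vertices:
  assumes "is_chain C a ms" "i \<le> j" "j \<le> length ms"
  shows "arrow C ((a # map (tgt C) ms) ! i) ((a # map (tgt C) ms) ! j)"
  using assms(2,3)
proof (induction j rule: dec_induct)
  case base
  have "set (a # map (tgt C) ms) \<subseteq> obs C"
    using is_chain_source_obs[OF assms(1)] is_chain_mors[OF assms(1)] tgt_closed by auto
  then have "(a # map (tgt C) ms) ! i \<in> obs C"
    using base nth_mem[of i "a # map (tgt C) ms"] by auto
  then show ?case by (rule arrow_refl)
next
  case (step j)
  have "src C (ms ! j) = (a # map (tgt C) ms) ! j"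
  proof (cases j)
    case 0
    then show ?thesis using step.prems assms(1) by (cases ms) auto
  next
    case (Suc l)
    then show ?thesis using step.prems is_chain_composable[OF assms(1), of l] by simp
  qed
  moreover have "ms ! j \<in> mors C" using step.prems is_chain_mors[OF assms(1)] by auto
  ultimately have "arrow C ((a # map (tgt C) ms) ! j) ((a # map (tgt C) ms) ! Suc j)"
    using step.prems by (auto simp: arrow_def)
  then show ?case using step arrow_trans by simp
qed

lemma (in category) verts_nerve_comparable:
  assumes "\<sigma> \<in> simps (nerve C) n" "u \<in> verts (nerve C) n \<sigma>" "v \<in> verts (nerve C) n \<sigma>"
  shows "\<exists>a b. u = nerve_vertex a \<and> v = nerve_vertex b \<and> (arrow C a b \<or> arrow C b a)"
proof -
  obtain a ms where \<sigma>: "\<sigma> = (a, ms)" "length ms = n" "is_chain C a ms"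
    using assms(1) by (auto simp: nerve_def)
  obtain i j where "i \<le> n" "j \<le> n"
    "u = nerve_vertex ((a # map (tgt C) ms) ! i)" "v = nerve_vertex ((a # map (tgt C) ms) ! j)"
    using assms(2,3) \<sigma> by (auto simp: verts_def vert_nerve)
  then show ?thesis using arrow_between_vertices[OF \<sigma>(3)] \<sigma>(2) by (metis nat_le_linear)
qed

context category_action
begin

lemma group_G: "group G"
  using obs_action.group_hom group_hom.axioms(1) by blast

lemma act_functor: "g \<in> carrier G \<Longrightarrow> cat_functor C C (\<alpha>o g) (\<alpha>m g)"
  using automorphism by (simp add: cat_automorphism_def)

lemma arrow_act:
  assumes "g \<in> carrier G" "arrow C a b"
  shows "arrow C (\<alpha>o g a) (\<alpha>o g b)"
proof -
  interpret F: cat_functor C C "\<alpha>o g" "\<alpha>m g" by (rule act_functor[OF assms(1)])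
  show ?thesis using assms(2) F.Fm_closed F.F_src F.F_tgt unfolding arrow_def by metis
qed

text \<open>Translating the arrow \<open>a \<rightarrow> g a\<close> by powers of \<open>g\<close> gives \<open>g a \<rightarrow> g\<^sup>2 a \<rightarrow> \<dots>\<close>, which returns
  to \<open>a\<close> because \<open>g\<close> has finite order.\<close>

lemma arrow_to_translate:
  assumes "acyclic_category C" "finite (carrier G)"
    and g: "g \<in> carrier G" and a: "a \<in> obs C" and ar: "arrow C a (\<alpha>o g a)"
  shows "\<alpha>o g a = a"
proof -
  interpret grp: group G by (rule group_G)
  interpret ac: acyclic_category C by fact
  have "arrow C (\<alpha>o g a) (\<alpha>o (g [^] Suc n) a)" for n
  proof (induction n)
    case 0
    then show ?case using arrow_refl obs_action.element_image g a by simp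
  next
    case (Suc n)
    have pow: "g [^] Suc n \<in> carrier G" using g by simp
    have "\<alpha>o (g [^] Suc n) (\<alpha>o g a) = \<alpha>o (g [^] Suc (Suc n)) a"
      using obs_action.composition_rule[OF a pow g] by simp
    then show ?case using arrow_trans[OF Suc arrow_act[OF pow ar]] by simp
  qed
  from this[of "order G - 1"] have "arrow C (\<alpha>o g a) (\<alpha>o \<one> a)"
    using grp.pow_order_eq_1[OF g] grp.order_gt_0_iff_finite assms(2) by simp
  then show ?thesis
    using ac.arrow_antisym[OF ar] obs_action.id_eq_one a by (metis restrict_apply')
qed

lemma is_chain_act:
  assumes "g \<in> carrier G"
  shows "is_chain C a ms \<Longrightarrow> is_chain C (\<alpha>o g a) (map (\<alpha>m g) ms)"
proof (induction ms arbitrary: a)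
  case Nil
  then show ?case using obs_action.element_image assms by auto
next
  case (Cons m ms)
  interpret F: cat_functor C C "\<alpha>o g" "\<alpha>m g" by (rule act_functor[OF assms])
  have m: "m \<in> mors C" "m \<notin> identities C" using Cons.prems by auto
  have "\<alpha>m g m \<notin> identities C"
  proof
    assume "\<alpha>m g m \<in> identities C"
    then obtain b where b: "b \<in> obs C" "\<alpha>m g m = idm C b" by (auto simp: identities_def)
    obtain b' where b': "b' \<in> obs C" "b = \<alpha>o g b'"
      using obs_action.surj_prop[OF assms] b(1) by blast
    then have "\<alpha>m g m = \<alpha>m g (idm C b')" using b(2) F.F_id by simp
    then have "m = idm C b'"
      using mors_action.inj_prop[OF assms] m(1) id_closed[OF b'(1)] by (simp add: inj_on_eq_iff)
    then show False using m(2) b'(1) by (auto simp: identities_def)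
  qed
  then show ?case using Cons F.Fm_closed F.F_src F.F_tgt by auto
qed

lemma trisp_action_nerve:
  assumes "trisp (nerve C)"
  shows "trisp_action G (nerve C) (nerve_action \<alpha>o \<alpha>m)"
proof -
  interpret grp: group G by (rule group_G)
  interpret nv: trisp "nerve C" by fact
  have chain: "fst \<sigma> \<in> obs C" "set (snd \<sigma>) \<subseteq> mors C" if in_nerve: "\<sigma> \<in> simps (nerve C) n" for \<sigma> n
  proof -
    obtain a ms where \<sigma>: "\<sigma> = (a, ms)" "is_chain C a ms" using in_nerve by (auto simp: nerve_def)
    then show "set (snd \<sigma>) \<subseteq> mors C" using is_chain_mors[OF \<sigma>(2)] \<sigma>(1) by simp
    show "fst \<sigma> \<in> obs C" using \<sigma> is_chain_source_obs by simp
  qed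
  show ?thesis
  proof
    fix g \<sigma> n assume "g \<in> carrier G" "\<sigma> \<in> simps (nerve C) n"
    then show "nerve_action \<alpha>o \<alpha>m g \<sigma> \<in> simps (nerve C) n"
      using is_chain_act by (auto simp: nerve_def nerve_action_def)
  next
    fix \<sigma> n assume \<sigma>: "\<sigma> \<in> simps (nerve C) n"
    have "\<alpha>o \<one> x = x" if "x \<in> obs C" for x
      using obs_action.id_eq_one that by (metis restrict_apply')
    moreover have "\<alpha>m \<one> f = f" if "f \<in> mors C" for f
      using mors_action.id_eq_one that by (metis restrict_apply')
    ultimately show "nerve_action \<alpha>o \<alpha>m \<one> \<sigma> = \<sigma>"
      using chain[OF \<sigma>] by (auto simp: nerve_action_def prod_eq_iff intro!: map_idI)
  next
    fix g h \<sigma> n assume gh: "g \<in> carrier G" "h \<in> carrier G" and \<sigma>: "\<sigma> \<in> simps (nerve C) n"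
    show "nerve_action \<alpha>o \<alpha>m (g \<otimes> h) \<sigma> = nerve_action \<alpha>o \<alpha>m g (nerve_action \<alpha>o \<alpha>m h \<sigma>)"
      using chain[OF \<sigma>] obs_action.composition_rule mors_action.composition_rule gh
      by (auto simp: nerve_action_def subset_iff)
  qed (rule nerve_bd_equivariant)
qed

lemma rigid_trisp_action_nerve:
  assumes "acyclic_category C" "finite (carrier G)" "trisp (nerve C)"
  shows "rigid_trisp_action G (nerve C) (nerve_action \<alpha>o \<alpha>m)"
proof -
  interpret grp: group G by (rule group_G)
  interpret ac: acyclic_category C by fact
  interpret ta: trisp_action G "nerve C" "nerve_action \<alpha>o \<alpha>m"
    by (rule trisp_action_nerve[OF assms(3)])
  show ?thesis
  proof
    fix \<sigma> n u g
    assume \<sigma>: "\<sigma> \<in> simps (nerve C) n" "u \<in> verts (nerve C) n \<sigma>"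
      "nerve_action \<alpha>o \<alpha>m g u \<in> verts (nerve C) n \<sigma>" and g: "g \<in> carrier G"
    obtain a b where ab: "u = nerve_vertex a" "nerve_action \<alpha>o \<alpha>m g u = nerve_vertex b"
        "arrow C a b \<or> arrow C b a"
      using verts_nerve_comparable[OF \<sigma>] by blast
    have b: "b = \<alpha>o g a" using ab by (simp add: nerve_vertex_def nerve_action_def)
    have obs: "a \<in> obs C" "b \<in> obs C"
      using ab(3) src_closed tgt_closed by (auto simp: arrow_def)
    have a: "a = \<alpha>o (inv g) b" using obs_action.orbit_sym_aux[OF g obs(1)] b by simp
    \<comment> \<open>an arrow in the backward direction is one from \<open>b\<close> to its translate by the inverse of \<open>g\<close>\<close>
    have "b = a"
      using ab(3)
    proof
      assume "arrow C a b"
      then show ?thesis using arrow_to_translate[OF assms(1,2) g obs(1)] b by simp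
    next
      assume "arrow C b a"
      then show ?thesis using arrow_to_translate[OF assms(1,2) grp.inv_closed[OF g] obs(2)] a by simp
    qed
    then show "nerve_action \<alpha>o \<alpha>m g u = u" using ab by simp
  qed
qed

end

theorem corollary8:
  fixes G :: "('g, 'x) monoid_scheme" and C :: "('o, 'm) category"
    and \<alpha>o :: "'g \<Rightarrow> 'o \<Rightarrow> 'o" and \<alpha>m :: "'g \<Rightarrow> 'm \<Rightarrow> 'm"
    and \<phi>o :: "'o \<Rightarrow> 'o" and \<phi>m :: "'m \<Rightarrow> 'm"
    and B R :: "'o set"
  assumes "group G" and "finite (carrier G)"
    and "finite_acyclic_category C"
    and "category_action G C \<alpha>o \<alpha>m"
    and "AC_map C \<phi>o \<phi>m"
    and "equivariant_functor G C \<alpha>o \<alpha>m \<phi>o \<phi>m"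
    and "induces_closure_map C \<phi>o B R"
    and "(\<Union>b\<in>B. orbit G \<alpha>o b) \<inter> (\<Union>r\<in>R. orbit G \<alpha>o r) = {}"
  shows "(\<forall>b\<in>B. quotient_vertex_map \<phi>o (vertex_orbit G \<alpha>o \<alpha>m b) = vertex_orbit G \<alpha>o \<alpha>m (\<phi>o b))
    \<and> trisp_closure_map (quotient_nerve G C \<alpha>o \<alpha>m)
         (vertex_orbit G \<alpha>o \<alpha>m ` B) (vertex_orbit G \<alpha>o \<alpha>m ` R) (quotient_vertex_map \<phi>o)"
proof -
  interpret group G by fact
  interpret category_action G C \<alpha>o \<alpha>m by fact
  interpret fac: finite_acyclic_category C by fact
  have BR: "B \<union> R = obs C" and
    cm: "trisp_closure_map (nerve C) (nerve_vertex ` B) (nerve_vertex ` R) (nerve_vertex_map \<phi>o)"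
    using assms(7) by (auto simp: induces_closure_map_def)
  have "trisp (nerve C)" using cm by (simp add: trisp_closure_map_def regular_trisp_def)
  then interpret rigid_trisp_action G "nerve C" "nerve_action \<alpha>o \<alpha>m"
    using rigid_trisp_action_nerve fac.acyclic_category_axioms assms(2) by blast
  have act_vertex: "nerve_action \<alpha>o \<alpha>m g (nerve_vertex a) = nerve_vertex (\<alpha>o g a)" for g a
    by (simp add: nerve_action_def nerve_vertex_def)
  have map_vertex: "nerve_vertex_map \<phi>o (nerve_vertex a) = nerve_vertex (\<phi>o a)" for a
    by (simp add: nerve_vertex_map_def nerve_vertex_def)
  have \<phi>_equiv: "\<phi>o (\<alpha>o g b) = \<alpha>o g (\<phi>o b)" if "g \<in> carrier G" "b \<in> B" for g b
    using assms(6) that BR by (auto simp: equivariant_functor_def)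
  have inv_B: "\<alpha>o g b \<in> B" if "g \<in> carrier G" "b \<in> B" for g b
  proof (rule ccontr)
    assume "\<alpha>o g b \<notin> B"
    moreover have "\<alpha>o g b \<in> obs C" using obs_action.element_image that BR by auto
    ultimately have "\<alpha>o g b \<in> R" using BR by auto
    moreover have "\<alpha>o g b \<in> orbit G \<alpha>o (\<alpha>o g b)"
      using obs_action.orbit_refl \<open>\<alpha>o g b \<in> obs C\<close> by simp
    moreover have "\<alpha>o g b \<in> orbit G \<alpha>o b" using that by (auto simp: orbit_def)
    ultimately show False using assms(8) that(2) by blast
  qed
  have "trisp_closure_map Q (orb ` nerve_vertex ` B) (orb ` nerve_vertex ` R)
      ((`) (nerve_vertex_map \<phi>o))"
    using cm by (rule trisp_closure_map_quotient)
      (auto simp: act_vertex map_vertex inv_B \<phi>_equiv)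
  then have "trisp_closure_map Q (vertex_orbit G \<alpha>o \<alpha>m ` B) (vertex_orbit G \<alpha>o \<alpha>m ` R)
      (quotient_vertex_map \<phi>o)"
    by (simp add: image_image vertex_orbit_def[abs_def] quotient_vertex_map_def[abs_def])
  moreover have "quotient_vertex_map \<phi>o (vertex_orbit G \<alpha>o \<alpha>m b) = vertex_orbit G \<alpha>o \<alpha>m (\<phi>o b)"
    if "b \<in> B" for b
    using \<phi>_equiv[OF _ that]
    by (simp add: quotient_vertex_map_def vertex_orbit_def orbit_def Setcompr_eq_image
        image_image act_vertex map_vertex)
  ultimately show ?thesis by blast
qed

end
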